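(* Let $\mathcal{L}$ be a countable language. For any equational theories $\Phi_0$ and $\Phi_1$ in $\mathcal{L}$, the interval $[\Phi_0,\Phi_1]$ has cardinality $\leq\aleph_0$ or $2^{\aleph_0}$.
   Context: We work in ZFC (no Continuum Hypothesis). A language is a set of function symbols, each with a specified finite arity; terms are built over a fixed countably infinite set of variables. An equation is an expression $s\approx t$ with $s,t$ terms. An equational theory is the set of all equations valid in some variety (class of algebras closed under homomorphic images, subalgebras and products); equivalently, a set of equations that contains all $s\approx s$, is symmetric and transitive, and is closed under replacement (if $s\approx s'$ is in the set, $t$ is a term and $t'$ results from replacing an occurrence of $s$ in $t$ by $s'$, then $t\approx t'$ is in the set) and under simultaneous substitution of terms for variables. The interval is $[\Phi_0,\Phi_1]=\{\Phi : \Phi \text{ is an equational theory in } \mathcal{L} \text{ with } \Phi_0\subseteq\Phi\subseteq\Phi_1\}$ (not necessarily linearly ordered). *)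

theory Defs
  imports Main "HOL-Library.Countable_Set" "HOL-Library.Equipollence"
begin

text \<open>
  A language is given by a set \<open>F\<close> of function symbols and an arity function \<open>ar\<close>, whose values
  outside \<open>F\<close> are irrelevant. The variables are the natural numbers. The datatype contains raw
  terms only; \<open>terms F ar\<close> selects the terms of the language.
\<close>

datatype 'f trm = Var nat | Fun 'f "'f trm list"

inductive_set terms :: "'f set \<Rightarrow> ('f \<Rightarrow> nat) \<Rightarrow> 'f trm set"
  for F :: "'f set" and ar :: "'f \<Rightarrow> nat" where
  Var: "Var x \<in> terms F ar"
| Fun: "\<lbrakk>f \<in> F; length ts = ar f; \<And>t. t \<in> set ts \<Longrightarrow> t \<in> terms F ar\<rbrakk> \<Longrightarrow> Fun f ts \<in> terms F ar"

primrec subst :: "(nat \<Rightarrow> 'f trm) \<Rightarrow> 'f trm \<Rightarrow> 'f trm" where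
  "subst \<sigma> (Var x) = \<sigma> x"
| "subst \<sigma> (Fun f ts) = Fun f (map (subst \<sigma>) ts)"

text \<open>
  \<open>replaces s s' t t'\<close>: the term \<open>t'\<close> results from \<open>t\<close> by replacing exactly one occurrence of the
  subterm \<open>s\<close> by \<open>s'\<close>.
\<close>

inductive replaces :: "'f trm \<Rightarrow> 'f trm \<Rightarrow> 'f trm \<Rightarrow> 'f trm \<Rightarrow> bool"
  for s s' :: "'f trm" where
  here: "replaces s s' s s'"
| arg: "replaces s s' t t' \<Longrightarrow> replaces s s' (Fun f (us @ t # vs)) (Fun f (us @ t' # vs))"

text \<open>The pair \<open>(s, t)\<close> encodes the equation \<open>s \<approx> t\<close>.\<close>

definition equational_theory ::
  "'f set \<Rightarrow> ('f \<Rightarrow> nat) \<Rightarrow> ('f trm \<times> 'f trm) set \<Rightarrow> bool" where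
  "equational_theory F ar \<Phi> \<longleftrightarrow>
     \<Phi> \<subseteq> terms F ar \<times> terms F ar \<and>
     (\<forall>s \<in> terms F ar. (s, s) \<in> \<Phi>) \<and>
     sym \<Phi> \<and>
     trans \<Phi> \<and>
     (\<forall>s s' t t'. (s, s') \<in> \<Phi> \<longrightarrow> t \<in> terms F ar \<longrightarrow> replaces s s' t t' \<longrightarrow> (t, t') \<in> \<Phi>) \<and>
     (\<forall>s t \<sigma>. (s, t) \<in> \<Phi> \<longrightarrow> (\<forall>x. \<sigma> x \<in> terms F ar) \<longrightarrow> (subst \<sigma> s, subst \<sigma> t) \<in> \<Phi>)"

definition theory_interval ::
  "'f set \<Rightarrow> ('f \<Rightarrow> nat) \<Rightarrow> ('f trm \<times> 'f trm) set \<Rightarrow> ('f trm \<times> 'f trm) set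
    \<Rightarrow> ('f trm \<times> 'f trm) set set" where
  "theory_interval F ar \<Phi>\<^sub>0 \<Phi>\<^sub>1 = {\<Phi>. equational_theory F ar \<Phi> \<and> \<Phi>\<^sub>0 \<subseteq> \<Phi> \<and> \<Phi> \<subseteq> \<Phi>\<^sub>1}"

end

theory Submission imports Defs begin

text \<open>
  A set of equations is a point of the Cantor space \<open>2\<^sup>E\<close>, where \<open>E\<close> is the set of all equations
  of the language, and \<open>E\<close> is countable because the language is. Each closure condition on an
  equational theory (reflexivity, symmetry, transitivity, replacement, substitution) and each of the
  bounds \<open>\<Phi>\<^sub>0 \<subseteq> \<Phi>\<close> and \<open>\<Phi> \<subseteq> \<Phi>\<^sub>1\<close> splits into requirements that mention at most three equations,
  so the interval is a closed subset of \<open>2\<^sup>E\<close> (\<open>pointwise_closed_theory_interval\<close>). By the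
  theorem of Cantor and Bendixson, a closed subset of the Cantor space is countable or has the
  cardinality of the continuum (\<open>countable_or_continuum_if_pointwise_closed\<close>).

  For the second alternative, a closed uncountable family \<open>C\<close> of subsets of a countable set contains a
  binary tree of uncountable subfamilies. The key is that some point \<open>x\<close> splits \<open>C\<close> into two
  uncountable halves (\<open>uncountable_family_splits\<close>). Along each branch the subfamilies also
  decide the points of the countable set one after the other, so they converge pointwise; the limit
  lies in \<open>C\<close> by closedness, and different branches have different limits.
\<close>

section \<open>The perfect set theorem for families of subsets of a countable set\<close>

text \<open>
  This is closedness in the product topology of \<open>2\<^sup>'\<^sup>a\<close>: the sets that agree with \<open>S\<close> on a finite
  set \<open>K\<close> form the basic neighbourhoods of \<open>S\<close>.
\<close>

definition pointwise_closed :: "'a set set \<Rightarrow> bool" where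
  "pointwise_closed C \<longleftrightarrow>
     (\<forall>S. (\<forall>K. finite K \<longrightarrow> (\<exists>T\<in>C. \<forall>x\<in>K. x \<in> T \<longleftrightarrow> x \<in> S)) \<longrightarrow> S \<in> C)"

text \<open>
  If no point split \<open>D\<close>, then at each point \<open>x\<close> all but countably many members would take the same
  side. The set \<open>M\<close> of the majority decisions would then be the only possible member of \<open>D\<close> outside
  a countable union of countable families.
\<close>

lemma uncountable_family_splits:
  assumes E: "countable E" and sub: "D \<subseteq> Pow E" and unc: "uncountable D"
  obtains x where "uncountable {S\<in>D. x \<in> S}" "uncountable {S\<in>D. x \<notin> S}"
proof -
  have "\<exists>x. uncountable {S\<in>D. x \<in> S} \<and> uncountable {S\<in>D. x \<notin> S}"
  proof (rule ccontr)
    assume no: "\<not> ?thesis"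
    define M where "M = {x\<in>E. uncountable {S\<in>D. x \<in> S}}"
    have "D \<subseteq> insert M (\<Union>x\<in>E. {S\<in>D. (x \<in> S) \<noteq> (x \<in> M)})"
    proof
      fix S assume S: "S \<in> D"
      show "S \<in> insert M (\<Union>x\<in>E. {S\<in>D. (x \<in> S) \<noteq> (x \<in> M)})"
      proof (cases "S = M")
        case False
        then obtain x where "(x \<in> S) \<noteq> (x \<in> M)" by blast
        moreover from this have "x \<in> E" using S sub by (auto simp: M_def)
        ultimately show ?thesis using S by blast
      qed simp
    qed
    moreover have "countable {S\<in>D. (x \<in> S) \<noteq> (x \<in> M)}" if "x \<in> E" for x
    proof (cases "x \<in> M")
      case True
      then show ?thesis using no by (auto simp: M_def)
    next
      case False
      then show ?thesis using that by (auto simp: M_def)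
    qed
    ultimately have "countable D"
      using E by (meson countable_UN countable_insert countable_subset)
    then show False using unc by simp
  qed
  then show ?thesis using that by blast
qed

text \<open>
  This is the step of the tree construction: \<open>b\<close> chooses the child, the point \<open>x\<close> keeps the two
  children apart, and deciding the prescribed point \<open>y\<close> is what makes branches converge.
\<close>

lemma uncountable_family_children:
  assumes E: "countable E" and sub: "D \<subseteq> Pow E" and unc: "uncountable D"
  obtains f x where
    "\<And>b::bool. f b \<subseteq> D" "\<And>b. uncountable (f b)"
    "\<And>b. \<forall>S\<in>f b. x \<in> S \<longleftrightarrow> b" "\<And>b. \<exists>c. \<forall>S\<in>f b. y \<in> S \<longleftrightarrow> c"
proof -
  obtain x where x: "uncountable {S\<in>D. x \<in> S}" "uncountable {S\<in>D. x \<notin> S}"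
    using uncountable_family_splits[OF assms] .
  have "\<exists>H\<subseteq>D. uncountable H \<and> (\<forall>S\<in>H. x \<in> S \<longleftrightarrow> b) \<and> (\<exists>c. \<forall>S\<in>H. y \<in> S \<longleftrightarrow> c)" for b
  proof -
    define G where "G = {S\<in>D. x \<in> S \<longleftrightarrow> b}"
    have "uncountable G" using x by (cases b) (simp_all add: G_def)
    moreover have "G = {S\<in>G. y \<in> S} \<union> {S\<in>G. y \<notin> S}" by blast
    ultimately have "uncountable {S\<in>G. y \<in> S} \<or> uncountable {S\<in>G. y \<notin> S}"
      by (metis countable_Un)
    then have "uncountable {S\<in>G. y \<in> S \<longleftrightarrow> True} \<or> uncountable {S\<in>G. y \<in> S \<longleftrightarrow> False}"
      by simp
    then obtain c where "uncountable {S\<in>G. y \<in> S \<longleftrightarrow> c}"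
      by blast
    then show ?thesis
      by (intro exI[of _ "{S\<in>G. y \<in> S \<longleftrightarrow> c}"]) (auto simp: G_def)
  qed
  then obtain f where
    f: "\<And>b. f b \<subseteq> D \<and> uncountable (f b) \<and> (\<forall>S\<in>f b. x \<in> S \<longleftrightarrow> b) \<and> (\<exists>c. \<forall>S\<in>f b. y \<in> S \<longleftrightarrow> c)"
    by metis
  show ?thesis by (rule that[of f x]) (use f in simp_all)
qed

text \<open>
  A branch of the tree is a set \<open>B\<close> of natural numbers, which takes the child \<open>n \<in> B\<close> at level \<open>n\<close>.
  Sending \<open>B\<close> to the limit of its branch is an injection into \<open>C\<close>.
\<close>

lemma nat_sets_lepoll_pointwise_closed:
  assumes E: "countable E" and sub: "C \<subseteq> Pow E" and unc: "uncountable C"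
    and closed: "pointwise_closed C"
  shows "(UNIV :: nat set set) \<lesssim> C"
proof -
  define good where "good D y f x \<longleftrightarrow>
    (\<forall>b::bool. f b \<subseteq> D \<and> uncountable (f b) \<and> (\<forall>S\<in>f b. x \<in> S \<longleftrightarrow> b) \<and> (\<exists>c. \<forall>S\<in>f b. y \<in> S \<longleftrightarrow> c))"
    for D :: "'a set set" and y x :: 'a and f
  have "\<exists>f x. good D y f x" if "D \<subseteq> C" "uncountable D" for D y
  proof (rule uncountable_family_children[OF E _ that(2), of y])
    show "D \<subseteq> Pow E" using that(1) sub by (rule subset_trans)
  next
    fix f x
    assume "\<And>b. f b \<subseteq> D" "\<And>b. uncountable (f b)"
      "\<And>b. \<forall>S\<in>f b. x \<in> S \<longleftrightarrow> b" "\<And>b. \<exists>c. \<forall>S\<in>f b. y \<in> S \<longleftrightarrow> c"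
    then have "good D y f x" by (simp add: good_def)
    then show ?thesis by blast
  qed
  then obtain child sep where
    child: "\<And>D y. D \<subseteq> C \<Longrightarrow> uncountable D \<Longrightarrow> good D y (child D y) (sep D y)"
    by metis
  define D where
    "D B = rec_nat C (\<lambda>n D'. child D' (from_nat_into E n) (n \<in> B))" for B :: "nat set"
  have D_0: "D B 0 = C" and
    D_Suc: "D B (Suc n) = child (D B n) (from_nat_into E n) (n \<in> B)" for B n
    by (simp_all add: D_def)
  have D_inv: "D B n \<subseteq> C \<and> uncountable (D B n)" for B n
  proof (induction n)
    case 0
    then show ?case using unc by (simp add: D_0)
  next
    case (Suc n)
    then have "good (D B n) (from_nat_into E n)
        (child (D B n) (from_nat_into E n)) (sep (D B n) (from_nat_into E n))"
      using child by simp
    then have "D B (Suc n) \<subseteq> D B n" "uncountable (D B (Suc n))"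
      by (simp_all add: good_def D_Suc)
    then show ?case using Suc by (meson subset_trans)
  qed
  have good: "good (D B n) (from_nat_into E n)
      (child (D B n) (from_nat_into E n)) (sep (D B n) (from_nat_into E n))" for B n
    using child D_inv by blast
  have D_step: "D B (Suc n) \<subseteq> D B n"
    and D_sep: "\<forall>S\<in>D B (Suc n). sep (D B n) (from_nat_into E n) \<in> S \<longleftrightarrow> n \<in> B"
    and D_decides: "\<exists>c. \<forall>S\<in>D B (Suc n). from_nat_into E n \<in> S \<longleftrightarrow> c" for B n
    using good[of B n] by (simp_all add: D_Suc good_def)
  have D_mono: "D B n \<subseteq> D B m" if "m \<le> n" for B m n
    using lift_Suc_antimono_le[of "D B", OF D_step that] .
  have D_nonempty: "D B n \<noteq> {}" for B n
    using D_inv[of B n] by auto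
  define Lim where "Lim B = {x. \<exists>n. \<forall>S\<in>D B n. x \<in> S}" for B
  \<comment> \<open>Two levels cannot decide a point differently, since the later family is a nonempty part of
    the earlier one.\<close>
  have Lim_eq: "x \<in> Lim B \<longleftrightarrow> c" if dec: "\<forall>S\<in>D B n. x \<in> S \<longleftrightarrow> c" for B n x c
  proof
    assume "x \<in> Lim B"
    then obtain m where m: "\<forall>S\<in>D B m. x \<in> S" by (auto simp: Lim_def)
    obtain S where "S \<in> D B (max m n)" using D_nonempty by blast
    moreover have "D B (max m n) \<subseteq> D B m" "D B (max m n) \<subseteq> D B n" by (simp_all add: D_mono)
    ultimately have "S \<in> D B m" "S \<in> D B n" by blast+
    then show c using m dec by blast
  next
    assume c
    then show "x \<in> Lim B" using dec by (auto simp: Lim_def)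
  qed
  have decided: "\<exists>n. \<forall>S\<in>D B n. x \<in> S \<longleftrightarrow> x \<in> Lim B" for B x
  proof (cases "x \<in> E")
    case True
    then obtain k where k: "from_nat_into E k = x"
      using E from_nat_into_surj by metis
    obtain c where c: "\<forall>S\<in>D B (Suc k). x \<in> S \<longleftrightarrow> c"
      using D_decides[of B k, unfolded k] ..
    show ?thesis using c unfolding Lim_eq[OF c, symmetric] ..
  next
    case False
    then have outside: "\<forall>S\<in>D B 0. x \<in> S \<longleftrightarrow> False" using sub by (auto simp: D_0)
    then show ?thesis unfolding Lim_eq[OF outside, symmetric] ..
  qed
  have "\<exists>n. \<forall>S\<in>D B n. \<forall>x\<in>K. x \<in> S \<longleftrightarrow> x \<in> Lim B" if "finite K" for B K
    using that
  proof induction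
    case (insert y K)
    then obtain m n where m: "\<forall>S\<in>D B m. \<forall>x\<in>K. x \<in> S \<longleftrightarrow> x \<in> Lim B"
      and n: "\<forall>S\<in>D B n. y \<in> S \<longleftrightarrow> y \<in> Lim B"
      using decided by metis
    have "D B (max m n) \<subseteq> D B m" "D B (max m n) \<subseteq> D B n" by (simp_all add: D_mono)
    then have "\<forall>S\<in>D B (max m n). \<forall>x\<in>insert y K. x \<in> S \<longleftrightarrow> x \<in> Lim B"
      using m n by blast
    then show ?case by blast
  qed simp
  then have "\<exists>T\<in>C. \<forall>x\<in>K. x \<in> T \<longleftrightarrow> x \<in> Lim B" if "finite K" for B K
    using that D_nonempty D_inv by (metis ex_in_conv subsetD)
  then have Lim_in: "Lim B \<in> C" for B
    using closed unfolding pointwise_closed_def by blast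
  have "inj Lim"
  proof (rule injI, rule ccontr)
    fix A B assume eq: "Lim A = Lim B" and "A \<noteq> B"
    then have ex: "\<exists>n. (n \<in> A) \<noteq> (n \<in> B)" by blast
    define n where "n = (LEAST n. (n \<in> A) \<noteq> (n \<in> B))"
    have differ: "(n \<in> A) \<noteq> (n \<in> B)"
      unfolding n_def by (rule LeastI_ex[OF ex])
    have agree: "(k \<in> A) = (k \<in> B)" if "k < n" for k
      using not_less_Least that unfolding n_def by blast
    \<comment> \<open>Both branches pass through the same node at level \<open>n\<close> and go to different children of it.\<close>
    have "D A m = D B m" if "m \<le> n" for m
      using that by (induction m) (simp_all add: D_0 D_Suc agree)
    then have same: "D A n = D B n" by simp
    define x where "x = sep (D A n) (from_nat_into E n)"
    have "x \<in> Lim A \<longleftrightarrow> n \<in> A"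
      unfolding x_def by (rule Lim_eq[OF D_sep])
    moreover have "x \<in> Lim B \<longleftrightarrow> n \<in> B"
      unfolding x_def same by (rule Lim_eq[OF D_sep])
    ultimately show False using eq differ by simp
  qed
  then show ?thesis
    unfolding lepoll_def using Lim_in by blast
qed

theorem countable_or_continuum_if_pointwise_closed:
  assumes E: "countable E" and sub: "C \<subseteq> Pow E" and closed: "pointwise_closed C"
  shows "countable C \<or> C \<approx> (UNIV :: nat set set)"
proof (cases "countable C")
  case False
  have "inj_on (image (to_nat_on E)) C"
    using inj_on_image_Pow[OF inj_on_to_nat_on[OF E]] sub by (rule inj_on_subset)
  then have "C \<lesssim> (UNIV :: nat set set)"
    unfolding lepoll_def by blast
  then show ?thesis
    using nat_sets_lepoll_pointwise_closed[OF E sub False closed] lepoll_antisym by blast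
qed simp

section \<open>Intervals of equational theories as closed families\<close>

instance trm :: (countable) countable
  by countable_datatype

text \<open>
  The type of the symbols may be uncountable. Numbering the symbols in \<open>F\<close> presents each term of the
  language as the image of a term over the countable alphabet \<^typ>\<open>nat\<close>.
\<close>

lemma countable_terms:
  assumes F: "countable F"
  shows "countable (terms F ar)"
proof -
  have "map_trm (from_nat_into F) (map_trm (to_nat_on F) t) = t" if "t \<in> terms F ar" for t
    using that
  proof induction
    case (Fun f ts)
    then show ?case using F by (simp add: map_idI)
  qed simp
  then have "terms F ar \<subseteq> range (map_trm (from_nat_into F))"
    by (metis rangeI subsetI)
  then show ?thesis
    by (rule countable_subset) simp
qed

text \<open>
  Each requirement on \<open>\<Phi>\<close> concerns a finite set of equations. A member of the interval that agrees
  with \<open>\<Phi>\<close> on this set satisfies the requirement, hence so does \<open>\<Phi>\<close>.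
\<close>

lemma pointwise_closed_theory_interval:
  "pointwise_closed (theory_interval F ar \<Phi>\<^sub>0 \<Phi>\<^sub>1)"
  unfolding pointwise_closed_def
proof (intro allI impI)
  fix \<Phi> :: "('a trm \<times> 'a trm) set"
  assume ap: "\<forall>K. finite K \<longrightarrow> (\<exists>T\<in>theory_interval F ar \<Phi>\<^sub>0 \<Phi>\<^sub>1. \<forall>e\<in>K. e \<in> T \<longleftrightarrow> e \<in> \<Phi>)"
  have approx: "\<exists>T. equational_theory F ar T \<and> \<Phi>\<^sub>0 \<subseteq> T \<and> T \<subseteq> \<Phi>\<^sub>1 \<and>
      (a \<in> T \<longleftrightarrow> a \<in> \<Phi>) \<and> (b \<in> T \<longleftrightarrow> b \<in> \<Phi>) \<and> (c \<in> T \<longleftrightarrow> c \<in> \<Phi>)" for a b c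
    using ap[rule_format, of "{a, b, c}"] by (auto simp: theory_interval_def)
  have "\<Phi>\<^sub>0 \<subseteq> \<Phi>" "\<Phi> \<subseteq> \<Phi>\<^sub>1"
    using approx by blast+
  moreover have "\<Phi> \<subseteq> terms F ar \<times> terms F ar"
    using approx unfolding equational_theory_def by blast
  moreover have "\<forall>s\<in>terms F ar. (s, s) \<in> \<Phi>"
    using approx unfolding equational_theory_def by blast
  moreover have "sym \<Phi>"
  proof (rule symI)
    fix s t assume "(s, t) \<in> \<Phi>"
    then show "(t, s) \<in> \<Phi>"
      using approx[of "(s, t)" "(t, s)"] unfolding equational_theory_def by (blast dest: symD)
  qed
  moreover have "trans \<Phi>"
  proof (rule transI)
    fix s t u assume "(s, t) \<in> \<Phi>" "(t, u) \<in> \<Phi>"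
    then show "(s, u) \<in> \<Phi>"
      using approx[of "(s, t)" "(t, u)" "(s, u)"] unfolding equational_theory_def
      by (blast dest: transD)
  qed
  moreover have "(t, t') \<in> \<Phi>"
    if "(s, s') \<in> \<Phi>" "t \<in> terms F ar" "replaces s s' t t'" for s s' t t'
    using approx[of "(s, s')" "(t, t')"] that unfolding equational_theory_def by blast
  moreover have "(subst \<sigma> s, subst \<sigma> t) \<in> \<Phi>"
    if "(s, t) \<in> \<Phi>" "\<forall>x. \<sigma> x \<in> terms F ar" for s t \<sigma>
    using approx[of "(s, t)" "(subst \<sigma> s, subst \<sigma> t)"] that unfolding equational_theory_def by blast
  ultimately show "\<Phi> \<in> theory_interval F ar \<Phi>\<^sub>0 \<Phi>\<^sub>1"
    unfolding theory_interval_def equational_theory_def by blast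
qed

theorem lemma3p2:
  fixes F :: "'f set" and ar :: "'f \<Rightarrow> nat"
    and \<Phi>\<^sub>0 \<Phi>\<^sub>1 :: "('f trm \<times> 'f trm) set"
  assumes "countable F"
    and "equational_theory F ar \<Phi>\<^sub>0"
    and "equational_theory F ar \<Phi>\<^sub>1"
  shows "countable (theory_interval F ar \<Phi>\<^sub>0 \<Phi>\<^sub>1) \<or>
         theory_interval F ar \<Phi>\<^sub>0 \<Phi>\<^sub>1 \<approx> (UNIV :: nat set set)"
proof (rule countable_or_continuum_if_pointwise_closed)
  show "countable (terms F ar \<times> terms F ar)"
    using countable_terms[OF assms(1)] by simp
  show "theory_interval F ar \<Phi>\<^sub>0 \<Phi>\<^sub>1 \<subseteq> Pow (terms F ar \<times> terms F ar)"
    by (auto simp: theory_interval_def equational_theory_def)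
  show "pointwise_closed (theory_interval F ar \<Phi>\<^sub>0 \<Phi>\<^sub>1)"
    by (rule pointwise_closed_theory_interval)
qed

end
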